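(* **1.** Let $G$ be a graph with nodes $1,\dots,n$ and stability number $\alpha(G)$, and let $r\ge 1$ be an integer. A minimum-degree Nullstellensatz certificate for the non-existence of a stable set of size $\alpha(G)+r$, i.e. a minimum-degree certificate $$1=A\Big(-(\alpha(G)+r)+\sum_{i=1}^n x_i\Big)+\sum_{i\in V(G)}Q_i\,(x_i^2-x_i)+\sum_{\{i,j\}\in E(G)}Q_{ij}\,x_ix_j,\qquad A,Q_i,Q_{ij}\in\mathbb{C}[x_1,\dots,x_n],$$ has degree equal to $\alpha(G)$ and contains at least one term per stable set in $G$ (that is, the total number of monomials occurring with non-zero coefficient in the coefficient polynomials $A,Q_i,Q_{ij}$ is at least the number of stable sets of $G$). **2.** Every Nullstellensatz certificate for non-3-colorability of a (non-3-colorable) graph has degree at least four. Moreover, if a graph contains an odd-wheel or a clique $K_n$ with $n\ge 4$ as a subgraph, then a minimum-degree Nullstellensatz certificate for its non-3-colorability has degree exactly four.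
   Context: Graphs are finite, undirected and simple. A stable set is a set of pairwise non-adjacent vertices; $\alpha(G)$ is the maximum size of a stable set. The degree of a certificate in Part 1 is $\max\{\deg A,\deg Q_i,\deg Q_{ij}\}$ over all coefficient polynomials; minimum-degree means of least degree among all certificates for the given system. A Nullstellensatz certificate for non-3-colorability of a graph $G$ with nodes $1,\dots,n$ is an identity $$1=\sum_{i\in V(G)}P_{\{i\}}\,(x_i^3-1)+\sum_{\{i,j\}\in E(G)}P_{\{ij\}}\,(x_i^2+x_ix_j+x_j^2),\qquad P_{\{i\}},P_{\{ij\}}\in\mathbb{C}[x_1,\dots,x_n];$$ its degree is the maximum of the degrees of the coefficient polynomials $P_{\{i\}},P_{\{ij\}}$. (The system $x_i^3-1=0$, $x_i^2+x_ix_j+x_j^2=0$ has a complex solution iff $G$ is 3-colorable.) An odd-wheel is a graph consisting of an odd cycle (the rim, of odd length at least 3) together with a center vertex adjacent to all rim vertices. *)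

theory Defs
  imports Complex_Main "HOL-Library.Poly_Mapping"
begin

section \<open>Polynomials over the complex numbers\<close>

text \<open>
  A monomial is a finitely supported exponent vector and a polynomial a finitely supported
  map from monomials to coefficients; the product of \<open>Poly_Mapping\<close> is the convolution product,
  so this type is the ring of complex polynomials in indeterminates indexed by \<open>'v\<close>.
\<close>

type_synonym 'v monomial = "'v \<Rightarrow>\<^sub>0 nat"
type_synonym 'v cpoly = "'v monomial \<Rightarrow>\<^sub>0 complex"

definition X :: "'v \<Rightarrow> 'v cpoly" where
  "X v = Poly_Mapping.single (Poly_Mapping.single v 1) 1"

definition polys_in :: "'v set \<Rightarrow> 'v cpoly set" where
  "polys_in V = {p. \<forall>m\<in>Poly_Mapping.keys p. Poly_Mapping.keys m \<subseteq> V}"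

definition monomial_degree :: "'v monomial \<Rightarrow> nat" where
  "monomial_degree m = (\<Sum>v\<in>Poly_Mapping.keys m. Poly_Mapping.lookup m v)"

text \<open>The zero polynomial gets degree 0.\<close>

definition poly_degree :: "'v cpoly \<Rightarrow> nat" where
  "poly_degree p = Max (insert 0 (monomial_degree ` Poly_Mapping.keys p))"

definition num_terms :: "'v cpoly \<Rightarrow> nat" where
  "num_terms p = card (Poly_Mapping.keys p)"

section \<open>Graphs\<close>

definition simple_graph :: "'v set \<Rightarrow> 'v set set \<Rightarrow> bool" where
  "simple_graph V E \<longleftrightarrow> finite V \<and> (\<forall>e\<in>E. \<exists>i\<in>V. \<exists>j\<in>V. i \<noteq> j \<and> e = {i, j})"

definition stable_sets :: "'v set \<Rightarrow> 'v set set \<Rightarrow> 'v set set" where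
  "stable_sets V E = {S. S \<subseteq> V \<and> pairwise (\<lambda>i j. {i, j} \<notin> E) S}"

definition stability_number :: "'v set \<Rightarrow> 'v set set \<Rightarrow> nat" where
  "stability_number V E = Max (card ` stable_sets V E)"

definition three_colorable :: "'v set \<Rightarrow> 'v set set \<Rightarrow> bool" where
  "three_colorable V E \<longleftrightarrow>
     (\<exists>c :: 'v \<Rightarrow> nat. c ` V \<subseteq> {..<3} \<and> (\<forall>i\<in>V. \<forall>j\<in>V. {i, j} \<in> E \<longrightarrow> c i \<noteq> c j))"

definition subgraph :: "'v set \<Rightarrow> 'v set set \<Rightarrow> 'v set \<Rightarrow> 'v set set \<Rightarrow> bool" where
  "subgraph W F V E \<longleftrightarrow> simple_graph W F \<and> W \<subseteq> V \<and> F \<subseteq> E"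

definition is_odd_wheel :: "'v set \<Rightarrow> 'v set set \<Rightarrow> bool" where
  "is_odd_wheel W F \<longleftrightarrow>
     (\<exists>c rim. distinct rim \<and> odd (length rim) \<and> length rim \<ge> 3 \<and> c \<notin> set rim \<and>
        W = insert c (set rim) \<and>
        F = {{rim ! i, rim ! (Suc i mod length rim)} | i. i < length rim} \<union> {{c, v} | v. v \<in> set rim})"

definition is_clique :: "nat \<Rightarrow> 'v set \<Rightarrow> 'v set set \<Rightarrow> bool" where
  "is_clique m W F \<longleftrightarrow> finite W \<and> card W = m \<and> F = {{i, j} | i j. i \<in> W \<and> j \<in> W \<and> i \<noteq> j}"

section \<open>Certificates for the non-existence of a stable set of size k\<close>

text \<open>Edges are two-element sets, so the product over an edge \<open>{i, j}\<close> is \<open>X i * X j\<close>.\<close>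

definition stable_certificate ::
  "'v set \<Rightarrow> 'v set set \<Rightarrow> nat \<Rightarrow> 'v cpoly \<Rightarrow> ('v \<Rightarrow> 'v cpoly) \<Rightarrow> ('v set \<Rightarrow> 'v cpoly) \<Rightarrow> bool" where
  "stable_certificate V E k A Q R \<longleftrightarrow>
     A \<in> polys_in V \<and> (\<forall>i\<in>V. Q i \<in> polys_in V) \<and> (\<forall>e\<in>E. R e \<in> polys_in V) \<and>
     1 = A * (- of_nat k + (\<Sum>i\<in>V. X i)) + (\<Sum>i\<in>V. Q i * ((X i)\<^sup>2 - X i))
         + (\<Sum>e\<in>E. R e * (\<Prod>i\<in>e. X i))"

definition stable_certificate_degree ::
  "'v set \<Rightarrow> 'v set set \<Rightarrow> 'v cpoly \<Rightarrow> ('v \<Rightarrow> 'v cpoly) \<Rightarrow> ('v set \<Rightarrow> 'v cpoly) \<Rightarrow> nat" where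
  "stable_certificate_degree V E A Q R =
     Max ({poly_degree A} \<union> (\<lambda>i. poly_degree (Q i)) ` V \<union> (\<lambda>e. poly_degree (R e)) ` E)"

definition min_stable_certificate ::
  "'v set \<Rightarrow> 'v set set \<Rightarrow> nat \<Rightarrow> 'v cpoly \<Rightarrow> ('v \<Rightarrow> 'v cpoly) \<Rightarrow> ('v set \<Rightarrow> 'v cpoly) \<Rightarrow> bool" where
  "min_stable_certificate V E k A Q R \<longleftrightarrow>
     stable_certificate V E k A Q R \<and>
     (\<forall>A' Q' R'. stable_certificate V E k A' Q' R' \<longrightarrow>
        stable_certificate_degree V E A Q R \<le> stable_certificate_degree V E A' Q' R')"

definition stable_certificate_terms ::
  "'v set \<Rightarrow> 'v set set \<Rightarrow> 'v cpoly \<Rightarrow> ('v \<Rightarrow> 'v cpoly) \<Rightarrow> ('v set \<Rightarrow> 'v cpoly) \<Rightarrow> nat" where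
  "stable_certificate_terms V E A Q R =
     num_terms A + (\<Sum>i\<in>V. num_terms (Q i)) + (\<Sum>e\<in>E. num_terms (R e))"

section \<open>Certificates for non-3-colorability\<close>

text \<open>
  On an edge \<open>{i, j}\<close> the second generator is \<open>(X i)\<^sup>2 + X i * X j + (X j)\<^sup>2\<close>, written
  without choosing an order on the endpoints; see \<open>edge_poly_doubleton\<close>.
\<close>

definition edge_poly :: "'v set \<Rightarrow> 'v cpoly" where
  "edge_poly e = (\<Sum>i\<in>e. (X i)\<^sup>2) + (\<Prod>i\<in>e. X i)"

lemma edge_poly_doubleton:
  "i \<noteq> j \<Longrightarrow> edge_poly {i, j} = (X i)\<^sup>2 + X i * X j + (X j)\<^sup>2"
  by (simp add: edge_poly_def algebra_simps)

definition coloring_certificate ::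
  "'v set \<Rightarrow> 'v set set \<Rightarrow> ('v \<Rightarrow> 'v cpoly) \<Rightarrow> ('v set \<Rightarrow> 'v cpoly) \<Rightarrow> bool" where
  "coloring_certificate V E P R \<longleftrightarrow>
     (\<forall>i\<in>V. P i \<in> polys_in V) \<and> (\<forall>e\<in>E. R e \<in> polys_in V) \<and>
     1 = (\<Sum>i\<in>V. P i * (X i ^ 3 - 1)) + (\<Sum>e\<in>E. R e * edge_poly e)"

text \<open>The maximum is over a nonempty set whenever \<open>P, R\<close> is a certificate.\<close>

definition coloring_certificate_degree ::
  "'v set \<Rightarrow> 'v set set \<Rightarrow> ('v \<Rightarrow> 'v cpoly) \<Rightarrow> ('v set \<Rightarrow> 'v cpoly) \<Rightarrow> nat" where
  "coloring_certificate_degree V E P R =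
     Max ((\<lambda>i. poly_degree (P i)) ` V \<union> (\<lambda>e. poly_degree (R e)) ` E)"

definition min_coloring_certificate ::
  "'v set \<Rightarrow> 'v set set \<Rightarrow> ('v \<Rightarrow> 'v cpoly) \<Rightarrow> ('v set \<Rightarrow> 'v cpoly) \<Rightarrow> bool" where
  "min_coloring_certificate V E P R \<longleftrightarrow>
     coloring_certificate V E P R \<and>
     (\<forall>P' R'. coloring_certificate V E P' R' \<longrightarrow>
        coloring_certificate_degree V E P R \<le> coloring_certificate_degree V E P' R')"

end

(*
  Part 1. Modulo the ideal of the vertex and edge polynomials every monomial reduces to the
  squarefree monomial on its support, or to 0 if the support is not stable, so the coefficient of
  the reduced A at a stable set S is the sum of the coefficients of A over all monomials with
  support S.  Reducing the certificate identity gives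
  (|S| - k) b(S) + sum_{i in S} b(S - i) = [S = {}], which determines b and makes it nonzero
  everywhere: A has a monomial with support S for each stable S.  Conversely, the A with exactly
  these coefficients on squarefree monomials extends to a certificate of degree alpha(G).

  Part 2. The lower bound uses a linear functional that takes the value 1 at the polynomial 1 and
  annihilates every multiple of a generator by a monomial of degree at most 3, whatever the graph.
  For the wheel, a triangle a, b, c with center variable a yields a^2 (a + b + c) with linear
  coefficients; the alternating sum round the odd rim gives a^2 (a + 2x) for a rim variable x, and
  4 (a^2 + a x + x^2) = 3 a^2 + (a + 2x)^2 together with a^3 = 1 gives 1 in degree 4.
*)
theory Submission
  imports Defs
begin

section \<open>Degrees and linear functionals on polynomials\<close>

lemma keys_monomial_add: "Poly_Mapping.keys (m + n) = Poly_Mapping.keys m \<union> Poly_Mapping.keys n"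
  for m n :: "'v monomial"
  by (auto simp: in_keys_iff lookup_add)

lemma monomial_degree_alt:
  assumes "finite W" "Poly_Mapping.keys m \<subseteq> W"
  shows "monomial_degree m = (\<Sum>v\<in>W. Poly_Mapping.lookup m v)"
  unfolding monomial_degree_def using assms
  by (intro sum.mono_neutral_left) (auto simp: in_keys_iff)

lemma monomial_degree_add: "monomial_degree (m + n) = monomial_degree m + monomial_degree n"
proof -
  let ?W = "Poly_Mapping.keys m \<union> Poly_Mapping.keys n"
  show ?thesis
    by (simp add: monomial_degree_alt[of ?W] keys_monomial_add lookup_add sum.distrib)
qed

lemma monomial_degree_single [simp]: "monomial_degree (Poly_Mapping.single v k) = k"
  by (simp add: monomial_degree_def)

lemma monomial_degree_zero [simp]: "monomial_degree 0 = 0"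
  by (simp add: monomial_degree_def)

lemma monomial_degree_1_cases:
  assumes "monomial_degree m = 1"
  obtains v where "m = Poly_Mapping.single v 1"
proof -
  from assms obtain v where v: "v \<in> Poly_Mapping.keys m"
    by (metis all_not_in_conv monomial_degree_def one_neq_zero sum.empty)
  have deg: "Poly_Mapping.lookup m v + (\<Sum>w\<in>Poly_Mapping.keys m - {v}. Poly_Mapping.lookup m w) = 1"
    using assms v by (simp add: monomial_degree_def sum.remove[of _ v])
  moreover have "Poly_Mapping.lookup m v \<noteq> 0"
    using v by (simp add: in_keys_iff)
  ultimately have *: "Poly_Mapping.lookup m v = 1"
    "(\<Sum>w\<in>Poly_Mapping.keys m - {v}. Poly_Mapping.lookup m w) = 0"
    by linarith+
  have "m = Poly_Mapping.single v 1"
  proof (rule poly_mapping_eqI)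
    fix w
    show "Poly_Mapping.lookup m w = Poly_Mapping.lookup (Poly_Mapping.single v 1) w"
      using * by (cases "w = v") (auto simp: lookup_single in_keys_iff)
  qed
  then show ?thesis by (rule that)
qed

lemma card_keys_le_monomial_degree: "card (Poly_Mapping.keys m) \<le> monomial_degree m"
  unfolding monomial_degree_def card_eq_sum
  by (intro sum_mono) (auto simp: in_keys_iff Suc_le_eq)

text \<open>Variables and degree are bounded together, monomial by monomial, so the closure
  properties need no maximum and 0 belongs for every \<open>d\<close>.\<close>

definition polys_upto :: "'v set \<Rightarrow> nat \<Rightarrow> 'v cpoly set" where
  "polys_upto V d = {p. \<forall>m\<in>Poly_Mapping.keys p. Poly_Mapping.keys m \<subseteq> V \<and> monomial_degree m \<le> d}"

lemma polys_upto_iff: "p \<in> polys_upto V d \<longleftrightarrow> p \<in> polys_in V \<and> poly_degree p \<le> d"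
  by (auto simp: polys_upto_def polys_in_def poly_degree_def)

lemma polys_upto_mono: "p \<in> polys_upto V d \<Longrightarrow> d \<le> d' \<Longrightarrow> p \<in> polys_upto V d'"
  by (auto simp: polys_upto_def)

lemma polys_upto_zero [simp]: "0 \<in> polys_upto V d"
  by (simp add: polys_upto_def)

lemma polys_upto_const [simp]: "Poly_Mapping.single 0 c \<in> polys_upto V d"
  by (simp add: polys_upto_def)

lemma polys_upto_one [simp]: "1 \<in> polys_upto V d"
  by (simp add: polys_upto_def)

lemma polys_upto_add: "p \<in> polys_upto V d \<Longrightarrow> q \<in> polys_upto V d \<Longrightarrow> p + q \<in> polys_upto V d"
  using keys_add[of p q] unfolding polys_upto_def by blast

lemma polys_upto_sum: "(\<And>i. i \<in> I \<Longrightarrow> p i \<in> polys_upto V d) \<Longrightarrow> sum p I \<in> polys_upto V d"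
  by (induction I rule: infinite_finite_induct) (auto intro: polys_upto_add)

lemma polys_upto_mult:
  assumes "p \<in> polys_upto V d" "q \<in> polys_upto V d'"
  shows "p * q \<in> polys_upto V (d + d')"
proof -
  have "Poly_Mapping.keys (a + b) \<subseteq> V \<and> monomial_degree (a + b) \<le> d + d'"
    if "a \<in> Poly_Mapping.keys p" "b \<in> Poly_Mapping.keys q" for a b
    using assms that by (auto simp: polys_upto_def keys_monomial_add monomial_degree_add add_mono)
  then show ?thesis
    using keys_mult[of p q] unfolding polys_upto_def by blast
qed

lemma polys_upto_power: "p \<in> polys_upto V d \<Longrightarrow> p ^ k \<in> polys_upto V (k * d)"
  by (induction k) (simp_all add: polys_upto_mult)

lemma polys_upto_X: "v \<in> V \<Longrightarrow> X v \<in> polys_upto V 1"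
  by (simp add: polys_upto_def X_def)

lemma polys_upto_prod_X: "finite S \<Longrightarrow> S \<subseteq> V \<Longrightarrow> (\<Prod>i\<in>S. X i) \<in> polys_upto V (card S)"
proof (induction S rule: finite_induct)
  case (insert i S)
  then show ?case
    using polys_upto_mult[OF polys_upto_X[of i V]] by fastforce
qed simp

section \<open>Linear functionals prescribed on monomials\<close>

definition lin_ext :: "('v monomial \<Rightarrow> complex) \<Rightarrow> 'v cpoly \<Rightarrow> complex" where
  "lin_ext h p = (\<Sum>m\<in>Poly_Mapping.keys p. Poly_Mapping.lookup p m * h m)"

lemma lin_ext_alt:
  assumes "finite M" "Poly_Mapping.keys p \<subseteq> M"
  shows "lin_ext h p = (\<Sum>m\<in>M. Poly_Mapping.lookup p m * h m)"
  unfolding lin_ext_def using assms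
  by (intro sum.mono_neutral_left) (auto simp: in_keys_iff)

lemma lin_ext_zero [simp]: "lin_ext h 0 = 0"
  by (simp add: lin_ext_def)

lemma lin_ext_one [simp]: "lin_ext h 1 = h 0"
  by (simp add: lin_ext_def)

lemma lin_ext_single: "lin_ext h (Poly_Mapping.single m c) = c * h m"
  by (simp add: lin_ext_def)

lemma lin_ext_add: "lin_ext h (p + q) = lin_ext h p + lin_ext h q"
proof -
  let ?M = "Poly_Mapping.keys p \<union> Poly_Mapping.keys q"
  show ?thesis
    using keys_add[of p q]
    by (simp add: lin_ext_alt[of ?M] lookup_add sum.distrib algebra_simps)
qed

lemma lin_ext_uminus: "lin_ext h (- p) = - lin_ext h p"
  by (simp add: lin_ext_def sum_negf)

lemma lin_ext_diff: "lin_ext h (p - q) = lin_ext h p - lin_ext h q"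
  using lin_ext_add[of h p "- q"] by (simp add: lin_ext_uminus)

lemma lin_ext_sum: "lin_ext h (sum p I) = (\<Sum>i\<in>I. lin_ext h (p i))"
  by (induction I rule: infinite_finite_induct) (auto simp: lin_ext_add)

lemma lin_ext_fun_add: "lin_ext (\<lambda>m. h m + h' m) p = lin_ext h p + lin_ext h' p"
  by (simp add: lin_ext_def sum.distrib algebra_simps)

lemma lin_ext_eq_0: "(\<And>m. m \<in> Poly_Mapping.keys p \<Longrightarrow> h m = 0) \<Longrightarrow> lin_ext h p = 0"
  by (simp add: lin_ext_def)

text \<open>Multiplication by a monomial becomes a shift of the weight. So a functional kills the
  multiple of a generator by \<open>p\<close> as soon as the shifted weights belonging to the terms
  of the generator cancel at every monomial of \<open>p\<close>.\<close>

lemma lin_ext_mult_single: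
  "lin_ext h (p * Poly_Mapping.single m c) = c * lin_ext (\<lambda>n. h (n + m)) p"
proof (induction p rule: update_induct)
  case (update p a b)
  \<comment> \<open>The induction rule supplies a monomial \<open>a\<close> that does not yet occur
    in \<open>p\<close>, so the update is the addition of a new term.\<close>
  have "Poly_Mapping.update a b p = Poly_Mapping.single a b + p"
    using update.hyps
    by (intro poly_mapping_eqI) (auto simp: lookup_update lookup_add lookup_single in_keys_iff)
  then show ?case
    by (simp add: distrib_right lin_ext_add mult_single lin_ext_single update.IH algebra_simps)
qed simp

section \<open>Combinations of generators with coefficients of bounded degree\<close>

text \<open>A truncation of the ideal spanned by the generators: \<open>d\<close> bounds the
  coefficients and not \<open>p\<close>, as in the degree of a certificate. Certificates are
  obtained by building up a suitable \<open>p\<close> with the closure rules and reading off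
  \<open>Q\<close> and \<open>R\<close> only at the end.\<close>

definition bounded_comb ::
  "'v set \<Rightarrow> 'v set set \<Rightarrow> ('v \<Rightarrow> 'v cpoly) \<Rightarrow> ('v set \<Rightarrow> 'v cpoly) \<Rightarrow> nat \<Rightarrow> 'v cpoly \<Rightarrow> bool" where
  "bounded_comb V E f g d p \<longleftrightarrow>
     (\<exists>Q R. (\<forall>i\<in>V. Q i \<in> polys_upto V d) \<and> (\<forall>e\<in>E. R e \<in> polys_upto V d) \<and>
        p = (\<Sum>i\<in>V. Q i * f i) + (\<Sum>e\<in>E. R e * g e))"

lemma bounded_comb_zero [simp]: "bounded_comb V E f g d 0"
  unfolding bounded_comb_def by (intro exI[of _ "\<lambda>_. 0"]) simp

lemma bounded_comb_add:
  assumes "bounded_comb V E f g d p" "bounded_comb V E f g d q"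
  shows "bounded_comb V E f g d (p + q)"
proof -
  obtain Q R where p: "\<forall>i\<in>V. Q i \<in> polys_upto V d" "\<forall>e\<in>E. R e \<in> polys_upto V d"
    "p = (\<Sum>i\<in>V. Q i * f i) + (\<Sum>e\<in>E. R e * g e)"
    using assms(1) unfolding bounded_comb_def by blast
  obtain Q' R' where q: "\<forall>i\<in>V. Q' i \<in> polys_upto V d" "\<forall>e\<in>E. R' e \<in> polys_upto V d"
    "q = (\<Sum>i\<in>V. Q' i * f i) + (\<Sum>e\<in>E. R' e * g e)"
    using assms(2) unfolding bounded_comb_def by blast
  show ?thesis
    unfolding bounded_comb_def
    by (intro exI[of _ "\<lambda>i. Q i + Q' i"] exI[of _ "\<lambda>e. R e + R' e"])
      (use p q in \<open>auto simp: polys_upto_add distrib_right sum.distrib\<close>)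
qed

lemma bounded_comb_sum:
  "(\<And>i. i \<in> I \<Longrightarrow> bounded_comb V E f g d (p i)) \<Longrightarrow> bounded_comb V E f g d (sum p I)"
  by (induction I rule: infinite_finite_induct) (auto intro: bounded_comb_add)

lemma bounded_comb_mult:
  assumes q: "q \<in> polys_upto V d'" and p: "bounded_comb V E f g d p"
  shows "bounded_comb V E f g (d' + d) (q * p)"
proof -
  obtain Q R where Q: "\<forall>i\<in>V. Q i \<in> polys_upto V d" and R: "\<forall>e\<in>E. R e \<in> polys_upto V d"
    and p: "p = (\<Sum>i\<in>V. Q i * f i) + (\<Sum>e\<in>E. R e * g e)"
    using p unfolding bounded_comb_def by blast
  have "q * p = (\<Sum>i\<in>V. q * Q i * f i) + (\<Sum>e\<in>E. q * R e * g e)"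
    unfolding p by (simp only: distrib_left sum_distrib_left mult.assoc)
  moreover have "\<forall>i\<in>V. q * Q i \<in> polys_upto V (d' + d)" "\<forall>e\<in>E. q * R e \<in> polys_upto V (d' + d)"
    using Q R by (simp_all add: polys_upto_mult[OF q])
  ultimately show ?thesis
    unfolding bounded_comb_def by (intro exI[of _ "\<lambda>i. q * Q i"] exI[of _ "\<lambda>e. q * R e"]) simp
qed

lemma bounded_comb_const_mult:
  "bounded_comb V E f g d p \<Longrightarrow> bounded_comb V E f g d (Poly_Mapping.single 0 c * p)"
  using bounded_comb_mult[OF polys_upto_const[of c V 0]] by fastforce

lemma bounded_comb_uminus: "bounded_comb V E f g d p \<Longrightarrow> bounded_comb V E f g d (- p)"
  using bounded_comb_const_mult[of V E f g d p "- 1"] by (simp add: single_uminus)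

lemma bounded_comb_diff:
  "bounded_comb V E f g d p \<Longrightarrow> bounded_comb V E f g d q \<Longrightarrow> bounded_comb V E f g d (p - q)"
  using bounded_comb_add[of V E f g d p "- q"] by (simp add: bounded_comb_uminus)

lemma bounded_comb_vertex:
  assumes "finite V" "i \<in> V" "q \<in> polys_upto V d"
  shows "bounded_comb V E f g d (q * f i)"
  unfolding bounded_comb_def
  by (intro exI[of _ "\<lambda>j. if j = i then q else 0"] exI[of _ "\<lambda>_. 0"])
    (use assms in \<open>simp add: if_distrib[of "\<lambda>p. p * _"] cong: if_cong\<close>)

lemma bounded_comb_edge:
  assumes "finite E" "e \<in> E" "q \<in> polys_upto V d"
  shows "bounded_comb V E f g d (q * g e)"
  unfolding bounded_comb_def
  by (intro exI[of _ "\<lambda>_. 0"] exI[of _ "\<lambda>e'. if e' = e then q else 0"])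
    (use assms in \<open>simp add: if_distrib[of "\<lambda>p. p * _"] cong: if_cong\<close>)

lemma simple_graph_finite_edges: "simple_graph V E \<Longrightarrow> finite E"
proof -
  assume "simple_graph V E"
  then have "E \<subseteq> Pow V" "finite V"
    by (auto simp: simple_graph_def)
  then show ?thesis
    using finite_subset by blast
qed

lemma simple_graph_edgeE:
  assumes "simple_graph V E" "e \<in> E"
  obtains i j where "i \<in> V" "j \<in> V" "i \<noteq> j" "e = {i, j}"
  using assms unfolding simple_graph_def by blast

section \<open>Stable sets\<close>

text \<open>The coefficients b(S) depend on S only through s = |S|. For s < k the closed form is -s!
  (k-s-1)! / k!; at s = k the divisor vanishes, hence the bounds s < k below.\<close>

primrec stable_coeff :: "nat \<Rightarrow> nat \<Rightarrow> complex" where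
  "stable_coeff k 0 = - 1 / of_nat k"
| "stable_coeff k (Suc s) = of_nat (Suc s) * stable_coeff k s / (of_nat k - of_nat (Suc s))"

lemma of_nat_diff_ne_0: "s < k \<Longrightarrow> of_nat k - of_nat s \<noteq> (0 :: 'a :: ring_char_0)"
  by (metis eq_iff_diff_eq_0 nat_neq_iff of_nat_eq_iff)

lemma stable_coeff_ne_0: "s < k \<Longrightarrow> stable_coeff k s \<noteq> 0"
proof (induction s)
  case (Suc s)
  then show ?case
    using of_nat_diff_ne_0[OF Suc.prems, where 'a = complex]
    by (simp del: of_nat_Suc)
qed simp

text \<open>This is the definition with the denominator cleared. At s = 0 the truncated s - 1 does
  no harm, because its term has the factor 0.\<close>

lemma stable_coeff_rec:
  assumes "s < k"
  shows "(of_nat s - of_nat k) * stable_coeff k s + of_nat s * stable_coeff k (s - 1) =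
    (if s = 0 then 1 else 0)"
proof (cases s)
  case (Suc t)
  have "(of_nat k - of_nat (Suc t)) * stable_coeff k (Suc t) = of_nat (Suc t) * stable_coeff k t"
    using of_nat_diff_ne_0[OF assms, where 'a = complex] Suc by (simp del: of_nat_Suc)
  then show ?thesis
    unfolding Suc by (simp add: algebra_simps del: of_nat_Suc stable_coeff.simps)
qed (use assms in simp)

section \<open>Basic facts on stable sets and the stability number\<close>

lemma stable_sets_subset: "S \<in> stable_sets V E \<Longrightarrow> T \<subseteq> S \<Longrightarrow> T \<in> stable_sets V E"
  by (auto simp: stable_sets_def intro: pairwise_subset)

lemma empty_in_stable_sets [simp]: "{} \<in> stable_sets V E"
  by (simp add: stable_sets_def)

lemma finite_stable_sets: "finite V \<Longrightarrow> finite (stable_sets V E)"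
  by (rule finite_subset[of _ "Pow V"]) (auto simp: stable_sets_def)

lemma finite_stable_set: "finite V \<Longrightarrow> S \<in> stable_sets V E \<Longrightarrow> finite S"
  using finite_subset by (auto simp: stable_sets_def)

lemma card_le_stability_number:
  "finite V \<Longrightarrow> S \<in> stable_sets V E \<Longrightarrow> card S \<le> stability_number V E"
  unfolding stability_number_def by (intro Max_ge) (auto simp: finite_stable_sets)

lemma stability_number_attained:
  assumes "finite V"
  obtains S where "S \<in> stable_sets V E" "card S = stability_number V E"
proof -
  have "stability_number V E \<in> card ` stable_sets V E"
    unfolding stability_number_def using assms
    by (intro Max_in) (auto simp: finite_stable_sets intro: empty_in_stable_sets)
  then show ?thesis using that by auto
qed

section \<open>Lower bounds on the degree and the number of terms\<close>

text \<open>Replacing every positive exponent by 1 reduces a polynomial modulo the vertex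
  generators; this functional is then the coefficient at the squarefree monomial on
  \<open>S\<close>.\<close>

definition supp_sum :: "'v set \<Rightarrow> 'v cpoly \<Rightarrow> complex" where
  "supp_sum S = lin_ext (\<lambda>m. if Poly_Mapping.keys m = S then 1 else 0)"

lemma supp_sum_mult_X:
  fixes S :: "'v set"
  shows "supp_sum S (p * X i) = (if i \<in> S then supp_sum S p + supp_sum (S - {i}) p else 0)"
proof -
  \<comment> \<open>Multiplication by x_i adds i to the support. The result is S iff i lies in S and
    the old support was S or S - {i}, and these two cases exclude each other.\<close>
  have *: "(if Poly_Mapping.keys (n + Poly_Mapping.single i 1) = S then 1 else 0 :: complex) =
      (if i \<in> S then (if Poly_Mapping.keys n = S then 1 else 0) +
        (if Poly_Mapping.keys n = S - {i} then 1 else 0) else 0)" for n :: "'v monomial"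
    by (auto simp: keys_monomial_add)
  show ?thesis
    unfolding supp_sum_def X_def lin_ext_mult_single *
    by (simp add: lin_ext_fun_add) (simp add: lin_ext_def)
qed

text \<open>After one multiplication by x_i every support contains i, so a second one changes
  nothing: the extra term at S - {i} is 0.\<close>

lemma supp_sum_idempotent: "supp_sum S (p * ((X i)\<^sup>2 - X i)) = 0"
proof -
  have "p * ((X i)\<^sup>2 - X i) = (p * X i) * X i - p * X i"
    by (simp add: power2_eq_square algebra_simps)
  then have "supp_sum S (p * ((X i)\<^sup>2 - X i)) = supp_sum S ((p * X i) * X i) - supp_sum S (p * X i)"
    by (simp add: supp_sum_def lin_ext_diff)
  also have "\<dots> = 0"
    by (subst supp_sum_mult_X) (simp add: supp_sum_mult_X)
  finally show ?thesis .
qed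

text \<open>Every monomial of the product has both ends of the edge in its support, which a stable
  set cannot contain.\<close>

lemma supp_sum_edge:
  assumes "simple_graph V E" "e \<in> E" "S \<in> stable_sets V E"
  shows "supp_sum S (p * (\<Prod>i\<in>e. X i)) = 0"
proof -
  obtain i j where e: "i \<noteq> j" "e = {i, j}"
    using assms by (auto elim: simple_graph_edgeE)
  then have "\<not> (i \<in> S \<and> j \<in> S)"
    using assms(2,3) by (auto simp: stable_sets_def pairwise_def)
  moreover have "p * (\<Prod>i\<in>e. X i) = p * X i * X j"
    using e by (simp add: mult.assoc)
  ultimately show ?thesis
    using e(1) by (auto simp: supp_sum_mult_X)
qed

text \<open>Applying the functional to the certificate identity kills the vertex and edge
  generators, so only \<open>A\<close> remains. The right-hand side is the value at 1, whose only
  monomial has empty support.\<close>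

lemma stable_certificate_supp_sum_rec:
  assumes graph: "simple_graph V E" and cert: "stable_certificate V E k A Q R"
    and S: "S \<in> stable_sets V E"
  shows "(of_nat (card S) - of_nat k) * supp_sum S A + (\<Sum>i\<in>S. supp_sum (S - {i}) A) =
    (if S = {} then 1 else 0)"
proof -
  have V: "finite V"
    using graph by (simp add: simple_graph_def)
  have SV: "S \<subseteq> V" "finite S"
    using S finite_stable_set[OF V S] by (simp_all add: stable_sets_def)
  have 1: "1 = A * (- of_nat k + (\<Sum>i\<in>V. X i)) + (\<Sum>i\<in>V. Q i * ((X i)\<^sup>2 - X i))
       + (\<Sum>e\<in>E. R e * (\<Prod>i\<in>e. X i))"
    using cert by (simp add: stable_certificate_def)
  have "supp_sum S 1 = supp_sum S (A * (- of_nat k + (\<Sum>i\<in>V. X i)))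
      + (\<Sum>i\<in>V. supp_sum S (Q i * ((X i)\<^sup>2 - X i))) + (\<Sum>e\<in>E. supp_sum S (R e * (\<Prod>i\<in>e. X i)))"
    by (subst 1) (simp only: supp_sum_def lin_ext_add lin_ext_sum)
  also have "\<dots> = supp_sum S (A * (- of_nat k + (\<Sum>i\<in>V. X i)))"
    using supp_sum_edge[OF graph _ S] by (simp add: supp_sum_idempotent)
  also have "A * (- of_nat k + (\<Sum>i\<in>V. X i)) =
      (\<Sum>i\<in>V. A * X i) - A * Poly_Mapping.single 0 (of_nat k)"
    by (simp add: algebra_simps sum_distrib_left)
  also have "supp_sum S \<dots> = (\<Sum>i\<in>V. supp_sum S (A * X i)) - of_nat k * supp_sum S A"
    by (simp only: supp_sum_def lin_ext_diff lin_ext_sum lin_ext_mult_single add_0_right)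
  \<comment> \<open>Vertices outside S contribute 0; each vertex of S contributes
    \<open>supp_sum S A\<close> once, which gives the factor \<open>card S\<close>.\<close>
  also have "(\<Sum>i\<in>V. supp_sum S (A * X i)) = (\<Sum>i\<in>S. supp_sum S A + supp_sum (S - {i}) A)"
    using SV V by (intro sum.mono_neutral_cong_right) (auto simp: supp_sum_mult_X)
  finally show ?thesis
    by (auto simp: supp_sum_def sum.distrib algebra_simps split: if_splits)
qed

text \<open>By induction on the size of S: \<open>stable_coeff\<close> satisfies the same
  recurrence, and the leading factor |S| - k is nonzero, so the value at S is forced by the values
  at the sets S - {i}.\<close>

lemma stable_certificate_supp_sum:
  assumes graph: "simple_graph V E" and cert: "stable_certificate V E k A Q R"
    and S: "S \<in> stable_sets V E" and k: "card S < k"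
  shows "supp_sum S A = stable_coeff k (card S)"
proof -
  have V: "finite V"
    using graph by (simp add: simple_graph_def)
  show ?thesis
    using S k
  proof (induction "card S" arbitrary: S)
    case 0
    have "S = {}"
      using 0 finite_stable_set[OF V] by auto
    then have "- of_nat k * supp_sum {} A = 1"
      using stable_certificate_supp_sum_rec[OF graph cert, of "{}"] by simp
    then have "of_nat k * supp_sum {} A = - 1"
      by (metis minus_mult_left minus_equation_iff)
    then have "supp_sum {} A = - 1 / of_nat k"
      using 0 by (subst nonzero_eq_divide_eq) (auto simp: mult.commute)
    then show ?case
      using \<open>S = {}\<close> by simp
  next
    case (Suc s)
    have "finite S"
      using Suc.prems finite_stable_set[OF V] by simp
    have "supp_sum (S - {i}) A = stable_coeff k s" if "i \<in> S" for i
    proof -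
      have "card (S - {i}) = s"
        using Suc.hyps(2) that \<open>finite S\<close> by simp
      moreover have "S - {i} \<in> stable_sets V E"
        using Suc.prems(1) by (rule stable_sets_subset) simp
      ultimately show ?thesis
        using Suc.hyps Suc.prems(2) by simp
    qed
    then have "(of_nat (card S) - of_nat k) * supp_sum S A + of_nat (card S) * stable_coeff k s = 0"
      using stable_certificate_supp_sum_rec[OF graph cert Suc.prems(1)] Suc.hyps(2) by (auto split: if_splits)
    moreover have "(of_nat (card S) - of_nat k) * stable_coeff k (card S) + of_nat (card S) * stable_coeff k s = 0"
      using stable_coeff_rec[OF Suc.prems(2)] Suc.hyps(2)
      by (metis diff_Suc_1 nat.distinct(1))
    ultimately have "(of_nat (card S) - of_nat k) * supp_sum S A =
        (of_nat (card S) - of_nat k) * stable_coeff k (card S)"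
      by (metis add_right_cancel)
    then show ?case
      using of_nat_diff_ne_0[OF Suc.prems(2), where 'a = complex] by auto
  qed
qed

text \<open>A nonzero sum of coefficients over the monomials with support S requires at least one
  such monomial in \<open>A\<close>.\<close>

lemma stable_certificate_supports:
  assumes "simple_graph V E" "stable_certificate V E k A Q R" "stability_number V E < k"
  shows "stable_sets V E \<subseteq> Poly_Mapping.keys ` Poly_Mapping.keys A"
proof
  fix S assume S: "S \<in> stable_sets V E"
  have "card S < k"
    using assms card_le_stability_number[OF _ S] by (auto simp: simple_graph_def)
  then have "supp_sum S A \<noteq> 0"
    using stable_certificate_supp_sum[OF assms(1,2) S] stable_coeff_ne_0 by simp
  then obtain m where "m \<in> Poly_Mapping.keys A" "Poly_Mapping.keys m = S"
    unfolding supp_sum_def using lin_ext_eq_0[of A] by (metis (mono_tags, lifting))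
  then show "S \<in> Poly_Mapping.keys ` Poly_Mapping.keys A"
    by blast
qed

lemma stable_certificate_terms_ge:
  assumes "simple_graph V E" "stable_certificate V E k A Q R" "stability_number V E < k"
  shows "card (stable_sets V E) \<le> stable_certificate_terms V E A Q R"
proof -
  \<comment> \<open>One monomial has only one support, so the terms of \<open>A\<close> alone are
    already numerous enough.\<close>
  have "card (stable_sets V E) \<le> num_terms A"
    unfolding num_terms_def using surj_card_le[OF _ stable_certificate_supports[OF assms]] by simp
  then show ?thesis
    by (simp add: stable_certificate_terms_def)
qed

lemma stable_certificate_degree_le_iff:
  assumes "simple_graph V E" "stable_certificate V E k A Q R"
  shows "stable_certificate_degree V E A Q R \<le> d \<longleftrightarrow>
    A \<in> polys_upto V d \<and> (\<forall>i\<in>V. Q i \<in> polys_upto V d) \<and> (\<forall>e\<in>E. R e \<in> polys_upto V d)"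
  using assms simple_graph_finite_edges[OF assms(1)]
  unfolding stable_certificate_degree_def stable_certificate_def simple_graph_def polys_upto_iff
  by (subst Max_le_iff) auto

text \<open>Take a maximum stable set S. Some monomial of \<open>A\<close> has support S, and each
  of its alpha(G) variables adds at least 1 to the degree. The bound concerns every certificate, not
  only a minimal one.\<close>

lemma stable_certificate_degree_ge:
  assumes "simple_graph V E" "stable_certificate V E k A Q R" "stability_number V E < k"
  shows "stability_number V E \<le> stable_certificate_degree V E A Q R"
proof -
  obtain S where "S \<in> stable_sets V E" "card S = stability_number V E"
    using assms(1) stability_number_attained by (auto simp: simple_graph_def)
  then obtain m where m: "m \<in> Poly_Mapping.keys A" "card (Poly_Mapping.keys m) = stability_number V E"
    using stable_certificate_supports[OF assms] by blast
  have "A \<in> polys_upto V (stable_certificate_degree V E A Q R)"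
    using stable_certificate_degree_le_iff[OF assms(1,2)] by blast
  then show ?thesis
    using m card_keys_le_monomial_degree[of m] by (auto simp: polys_upto_def)
qed

section \<open>Construction of a certificate of degree alpha(G)\<close>

definition stable_monomial :: "'v set \<Rightarrow> 'v cpoly" where
  "stable_monomial S = (\<Prod>i\<in>S. X i)"

lemma stable_monomial_remove:
  "finite S \<Longrightarrow> i \<in> S \<Longrightarrow> stable_monomial S = X i * stable_monomial (S - {i})"
  unfolding stable_monomial_def by (rule prod.remove)

text \<open>Stated for subsets because the reductions below use monomials on S with one vertex
  removed as coefficients.\<close>

lemma stable_monomial_upto:
  assumes "finite V" "T \<subseteq> S" "S \<in> stable_sets V E"
  shows "stable_monomial T \<in> polys_upto V (stability_number V E)"
proof -
  have T: "T \<in> stable_sets V E"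
    using stable_sets_subset[OF assms(3,2)] .
  then have "T \<subseteq> V"
    by (simp add: stable_sets_def)
  then show ?thesis
    unfolding stable_monomial_def
    using polys_upto_mono[OF polys_upto_prod_X card_le_stability_number[OF assms(1) T]]
      finite_stable_set[OF assms(1) T] by simp
qed

text \<open>One step of reduction to normal form. If i is in S, the vertex generator of i removes
  the square; if S with i is stable, nothing has to be done; otherwise some j in S is adjacent to i,
  and the edge generator of ij kills the product.\<close>

lemma stable_monomial_mult_X:
  assumes graph: "simple_graph V E" and S: "S \<in> stable_sets V E" and i: "i \<in> V"
  shows "bounded_comb V E (\<lambda>i. (X i)\<^sup>2 - X i) (\<lambda>e. \<Prod>i\<in>e. X i) (stability_number V E)
    (stable_monomial S * X i -
      (if i \<in> S then stable_monomial S
       else if insert i S \<in> stable_sets V E then stable_monomial (insert i S) else 0))"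
    (is "bounded_comb V E ?f ?g ?d ?p")
proof -
  have V: "finite V" and E: "finite E"
    using graph simple_graph_finite_edges by (auto simp: simple_graph_def)
  have fin: "finite S"
    using finite_stable_set[OF V S] .
  consider "i \<in> S" | "i \<notin> S" "insert i S \<in> stable_sets V E" | "i \<notin> S" "insert i S \<notin> stable_sets V E"
    by blast
  then show ?thesis
  proof cases
    case 1
    have "?p = stable_monomial (S - {i}) * ((X i)\<^sup>2 - X i)"
      using stable_monomial_remove[OF fin 1] 1 by (simp add: power2_eq_square algebra_simps)
    then show ?thesis
      using bounded_comb_vertex[OF V i stable_monomial_upto[OF V Diff_subset S], of E ?f ?g "{i}"]
      by simp
  next
    case 2
    then have "?p = 0"
      using fin by (simp add: stable_monomial_def mult.commute)
    then show ?thesis by simp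
  next
    case 3
    then obtain j where j: "j \<in> S" "{i, j} \<in> E"
      using S i unfolding stable_sets_def pairwise_def by (auto simp: insert_commute)
    then have "i \<noteq> j"
      using 3 by auto
    then have "?p = stable_monomial (S - {j}) * ?g {i, j}"
      using stable_monomial_remove[OF fin j(1)] 3 by (simp add: algebra_simps)
    then show ?thesis
      using bounded_comb_edge[OF E j(2) stable_monomial_upto[OF V Diff_subset S], of ?f ?g "{j}"]
      by simp
  qed
qed

text \<open>Double counting: pairs of S and a vertex i extending it correspond to pairs of T and a
  vertex i of T, through T = S with i added.\<close>

lemma sum_stable_extensions:
  fixes F :: "'v set \<Rightarrow> 'v set \<Rightarrow> 'a :: comm_monoid_add"
  assumes "finite V"
  shows "(\<Sum>S\<in>stable_sets V E. \<Sum>i\<in>{i\<in>V - S. insert i S \<in> stable_sets V E}. F S (insert i S)) =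
    (\<Sum>T\<in>stable_sets V E. \<Sum>i\<in>T. F (T - {i}) T)"
proof -
  have "(\<Sum>S\<in>stable_sets V E. \<Sum>i\<in>{i\<in>V - S. insert i S \<in> stable_sets V E}. F S (insert i S)) =
    (\<Sum>(S, i)\<in>(SIGMA S:stable_sets V E. {i\<in>V - S. insert i S \<in> stable_sets V E}). F S (insert i S))"
    using assms by (intro sum.Sigma) (auto simp: finite_stable_sets)
  also have "\<dots> = (\<Sum>(T, i)\<in>(SIGMA T:stable_sets V E. T). F (T - {i}) T)"
    by (rule sum.reindex_bij_witness[where i = "\<lambda>(T, i). (T - {i}, i)"
          and j = "\<lambda>(S, i). (insert i S, i)"])
      (auto simp: insert_absorb stable_sets_subset[OF _ Diff_subset] stable_sets_def
        intro: pairwise_subset)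
  also have "\<dots> = (\<Sum>T\<in>stable_sets V E. \<Sum>i\<in>T. F (T - {i}) T)"
    using assms by (intro sum.Sigma[symmetric]) (auto simp: finite_stable_sets finite_stable_set)
  finally show ?thesis .
qed

lemma stable_certificate_exists:
  fixes E :: "'v set set"
  assumes graph: "simple_graph V E" and k: "stability_number V E < k"
  obtains A Q R where "stable_certificate V E k A Q R"
    "stable_certificate_degree V E A Q R \<le> stability_number V E"
proof -
  let ?d = "stability_number V E"
  let ?st = "stable_sets V E"
  let ?f = "\<lambda>i::'v. (X i)\<^sup>2 - X i" and ?g = "\<lambda>e::'v set. \<Prod>i\<in>e. X i"
  have V: "finite V"
    using graph by (simp add: simple_graph_def)
  define c :: "'v set \<Rightarrow> 'v cpoly" where "c S = Poly_Mapping.single 0 (stable_coeff k (card S))" for S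
  \<comment> \<open>The normal form of \<open>stable_monomial S * X i\<close> given by
    \<open>stable_monomial_mult_X\<close>.\<close>
  define N where "N S i = (if i \<in> S then stable_monomial S
    else if insert i S \<in> ?st then stable_monomial (insert i S) else 0)" for S i
  define A where "A = (\<Sum>S\<in>?st. c S * stable_monomial S)"
  have "stable_monomial S \<in> polys_upto V ?d" if "S \<in> ?st" for S
    using stable_monomial_upto[OF V subset_refl that] .
  then have A: "A \<in> polys_upto V ?d"
    unfolding A_def c_def using polys_upto_mult[OF polys_upto_const[of _ V 0]]
    by (intro polys_upto_sum) fastforce
  have N_sum: "(\<Sum>i\<in>V. N S i) = of_nat (card S) * stable_monomial S +
      (\<Sum>i\<in>{i\<in>V - S. insert i S \<in> ?st}. stable_monomial (insert i S))" if "S \<in> ?st" for S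
  proof -
    have "S \<subseteq> V" "finite S"
      using that finite_stable_set[OF V that] by (simp_all add: stable_sets_def)
    then have "(\<Sum>i\<in>V. N S i) = (\<Sum>i\<in>S. N S i) + (\<Sum>i\<in>V - S. N S i)"
      using V by (metis add.commute sum.subset_diff)
    also have "(\<Sum>i\<in>S. N S i) = of_nat (card S) * stable_monomial S"
      by (simp add: N_def)
    also have "(\<Sum>i\<in>V - S. N S i) =
        (\<Sum>i\<in>V - S. if insert i S \<in> ?st then stable_monomial (insert i S) else 0)"
      by (intro sum.cong) (auto simp: N_def)
    also have "\<dots> = (\<Sum>i\<in>{i\<in>V - S. insert i S \<in> ?st}. stable_monomial (insert i S))"
      using V by (intro sum.inter_filter[symmetric]) simp
    finally show ?thesis .
  qed
  \<comment> \<open>The left-hand side is the coefficient at \<open>stable_monomial T\<close> in the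
    normal form of A (x_1 + ... + x_n - k), so the recurrence leaves only the constant 1.\<close>
  have coeff: "c T * (of_nat (card T) - of_nat k) + (\<Sum>i\<in>T. c (T - {i})) = (if T = {} then 1 else 0)"
    if "T \<in> ?st" for T
  proof -
    have fin: "finite T" "card T < k"
      using finite_stable_set[OF V that] card_le_stability_number[OF V that] k by auto
    have "(\<Sum>i\<in>T. c (T - {i})) = (\<Sum>i\<in>T. Poly_Mapping.single 0 (stable_coeff k (card T - 1)))"
      using fin by (intro sum.cong) (simp_all add: c_def)
    also have "\<dots> = Poly_Mapping.single 0 (of_nat (card T) * stable_coeff k (card T - 1))"
      by (simp add: mult_single flip: single_of_nat)
    moreover have "c T * (of_nat (card T) - of_nat k) =
        Poly_Mapping.single 0 ((of_nat (card T) - of_nat k) * stable_coeff k (card T))"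
      by (simp add: c_def mult_single mult.commute flip: single_of_nat single_diff)
    ultimately show ?thesis
      using stable_coeff_rec[OF fin(2)] fin(1) by (simp flip: single_add)
  qed
  \<comment> \<open>Regrouping by the resulting stable set shows that this normal form is 1.\<close>
  have "(\<Sum>S\<in>?st. c S * ((\<Sum>i\<in>V. N S i) - of_nat k * stable_monomial S)) =
      (\<Sum>S\<in>?st. c S * (of_nat (card S) - of_nat k) * stable_monomial S) +
      (\<Sum>S\<in>?st. \<Sum>i\<in>{i\<in>V - S. insert i S \<in> ?st}. c S * stable_monomial (insert i S))"
    unfolding sum.distrib[symmetric]
    by (intro sum.cong) (simp_all add: N_sum algebra_simps sum_distrib_left)
  also have "(\<Sum>S\<in>?st. \<Sum>i\<in>{i\<in>V - S. insert i S \<in> ?st}. c S * stable_monomial (insert i S)) =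
      (\<Sum>T\<in>?st. \<Sum>i\<in>T. c (T - {i}) * stable_monomial T)"
    using sum_stable_extensions[OF V, where F = "\<lambda>S T. c S * stable_monomial T"] .
  also have "(\<Sum>S\<in>?st. c S * (of_nat (card S) - of_nat k) * stable_monomial S) + \<dots> =
      (\<Sum>T\<in>?st. (if T = {} then 1 else 0))"
    unfolding sum.distrib[symmetric]
  proof (intro sum.cong refl)
    fix T assume "T \<in> ?st"
    have "c T * (of_nat (card T) - of_nat k) * stable_monomial T + (\<Sum>i\<in>T. c (T - {i}) * stable_monomial T) =
        (c T * (of_nat (card T) - of_nat k) + (\<Sum>i\<in>T. c (T - {i}))) * stable_monomial T"
      by (simp only: distrib_right sum_distrib_right)
    also have "\<dots> = (if T = {} then 1 else 0)"
      unfolding coeff[OF \<open>T \<in> ?st\<close>] by (simp add: stable_monomial_def)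
    finally show "c T * (of_nat (card T) - of_nat k) * stable_monomial T +
      (\<Sum>i\<in>T. c (T - {i}) * stable_monomial T) = (if T = {} then 1 else 0)" .
  qed
  also have "\<dots> = 1"
    using V by (simp add: finite_stable_sets)
  finally have main: "(\<Sum>S\<in>?st. c S * ((\<Sum>i\<in>V. N S i) - of_nat k * stable_monomial S)) = 1" .
  \<comment> \<open>The product is its normal form plus the errors of the single reductions; those
    errors are combinations of vertex and edge generators with coefficients of degree at most
    alpha(G), and they supply \<open>Q\<close> and \<open>R\<close>.\<close>
  have "A * (- of_nat k + (\<Sum>i\<in>V. X i)) =
      (\<Sum>S\<in>?st. c S * (\<Sum>i\<in>V. stable_monomial S * X i - N S i)) +
      (\<Sum>S\<in>?st. c S * ((\<Sum>i\<in>V. N S i) - of_nat k * stable_monomial S))"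
    unfolding A_def sum.distrib[symmetric] sum_distrib_right
    by (intro sum.cong refl) (simp add: algebra_simps sum_subtractf sum_distrib_left)
  then have eq: "1 - A * (- of_nat k + (\<Sum>i\<in>V. X i)) =
      - (\<Sum>S\<in>?st. c S * (\<Sum>i\<in>V. stable_monomial S * X i - N S i))"
    by (simp add: main)
  have "bounded_comb V E ?f ?g ?d (c S * (\<Sum>i\<in>V. stable_monomial S * X i - N S i))"
    if "S \<in> ?st" for S
    unfolding c_def N_def
    using stable_monomial_mult_X[OF graph that]
    by (intro bounded_comb_const_mult bounded_comb_sum)
  then have "bounded_comb V E ?f ?g ?d (1 - A * (- of_nat k + (\<Sum>i\<in>V. X i)))"
    unfolding eq by (intro bounded_comb_uminus bounded_comb_sum)
  then obtain Q R where QR: "\<forall>i\<in>V. Q i \<in> polys_upto V ?d" "\<forall>e\<in>E. R e \<in> polys_upto V ?d"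
    "1 - A * (- of_nat k + (\<Sum>i\<in>V. X i)) = (\<Sum>i\<in>V. Q i * ?f i) + (\<Sum>e\<in>E. R e * ?g e)"
    unfolding bounded_comb_def by blast
  have cert: "stable_certificate V E k A Q R"
    using A QR by (auto simp: stable_certificate_def polys_upto_iff diff_eq_eq ac_simps)
  moreover have "stable_certificate_degree V E A Q R \<le> ?d"
    using A QR by (simp add: stable_certificate_degree_le_iff[OF graph cert])
  ultimately show ?thesis
    by (rule that)
qed

section \<open>Three-colorings\<close>

text \<open>
  Invariant under cubes by design. In degree 3 the values are 1 at \<open>i\<^sup>3\<close> and \<open>ijk\<close> and \<open>-1/2\<close> at
  \<open>i\<^sup>2j\<close>, so that every variable multiple of an edge polynomial is annihilated.
\<close>

definition coloring_weight :: "'v monomial \<Rightarrow> complex" where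
  "coloring_weight m =
     (if 3 dvd monomial_degree m
      then if \<exists>v. Poly_Mapping.lookup m v mod 3 = 2 then - 1 / 2 else 1
      else 0)"

text \<open>The weight sees the degree and the exponents only modulo 3.\<close>

lemma coloring_weight_cube: "coloring_weight (m + Poly_Mapping.single i 3) = coloring_weight m"
proof -
  have "Poly_Mapping.lookup (m + Poly_Mapping.single i 3) v mod 3 = Poly_Mapping.lookup m v mod 3" for v
    by (simp add: lookup_add lookup_single when_def)
  then show ?thesis
    by (simp add: coloring_weight_def monomial_degree_add)
qed

text \<open>The three monomials have degree deg m + 2, so for deg m at most 3 they can have nonzero
  weight only when m is a variable; then one weight is 1 and two are -1/2. The bound 3 is sharp: for
  distinct i, j, k and m = i j k^2 all three weights are -1/2.\<close>

lemma coloring_weight_edge: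
  assumes "i \<noteq> j" "monomial_degree m \<le> 3"
  shows "coloring_weight (m + Poly_Mapping.single i 2) +
    coloring_weight (m + (Poly_Mapping.single i 1 + Poly_Mapping.single j 1)) +
    coloring_weight (m + Poly_Mapping.single j 2) = 0"
proof (cases "monomial_degree m = 1")
  case True
  then obtain k where m: "m = Poly_Mapping.single k 1"
    by (rule monomial_degree_1_cases)
  have weight: "coloring_weight n = (if \<exists>v. Poly_Mapping.lookup n v mod 3 = 2 then - 1 / 2 else 1)"
    if "monomial_degree n = 3" for n :: "'a monomial"
    using that by (simp add: coloring_weight_def)
  consider "k = i" | "k = j" | "k \<noteq> i" "k \<noteq> j"
    by blast
  then show ?thesis
  proof cases
    case 1
    have "\<not> (\<exists>v. Poly_Mapping.lookup (m + Poly_Mapping.single i 2) v mod 3 = 2)"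
      using 1 m by (auto simp: lookup_add lookup_single when_def)
    moreover have "Poly_Mapping.lookup (m + (Poly_Mapping.single i 1 + Poly_Mapping.single j 1)) i mod 3 = 2"
      "Poly_Mapping.lookup (m + Poly_Mapping.single j 2) j mod 3 = 2"
      using 1 m assms(1) by (auto simp: lookup_add lookup_single when_def)
    ultimately show ?thesis
      using m by (subst (1 2 3) weight) (auto simp: monomial_degree_add)
  next
    case 2
    have "\<not> (\<exists>v. Poly_Mapping.lookup (m + Poly_Mapping.single j 2) v mod 3 = 2)"
      using 2 m by (auto simp: lookup_add lookup_single when_def)
    moreover have "Poly_Mapping.lookup (m + (Poly_Mapping.single i 1 + Poly_Mapping.single j 1)) j mod 3 = 2"
      "Poly_Mapping.lookup (m + Poly_Mapping.single i 2) i mod 3 = 2"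
      using 2 m assms(1) by (auto simp: lookup_add lookup_single when_def)
    ultimately show ?thesis
      using m by (subst (1 2 3) weight) (auto simp: monomial_degree_add)
  next
    case 3
    have "\<not> (\<exists>v. Poly_Mapping.lookup (m + (Poly_Mapping.single i 1 + Poly_Mapping.single j 1)) v mod 3 = 2)"
      using 3 m assms(1) by (auto simp: lookup_add lookup_single when_def)
    moreover have "Poly_Mapping.lookup (m + Poly_Mapping.single i 2) i mod 3 = 2"
      "Poly_Mapping.lookup (m + Poly_Mapping.single j 2) j mod 3 = 2"
      using 3 m by (auto simp: lookup_add lookup_single when_def)
    ultimately show ?thesis
      using m by (subst (1 2 3) weight) (auto simp: monomial_degree_add)
  qed
next
  case False
  then have "monomial_degree m = 0 \<or> monomial_degree m = 2 \<or> monomial_degree m = 3"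
    using assms(2) by linarith
  then have "\<not> 3 dvd monomial_degree m + 2"
    by presburger
  then show ?thesis
    by (simp add: coloring_weight_def monomial_degree_add)
qed

lemma X_power: "X i ^ k = Poly_Mapping.single (Poly_Mapping.single i k) 1"
  by (induction k) (simp_all add: X_def mult_single flip: single_add)

lemma coloring_certificate_degree_le_iff:
  assumes graph: "simple_graph V E" and cert: "coloring_certificate V E P R"
  shows "coloring_certificate_degree V E P R \<le> d \<longleftrightarrow>
    (\<forall>i\<in>V. P i \<in> polys_upto V d) \<and> (\<forall>e\<in>E. R e \<in> polys_upto V d)"
proof -
  have fin: "finite V" "finite E"
    using graph simple_graph_finite_edges by (auto simp: simple_graph_def)
  \<comment> \<open>With neither vertices nor edges the identity would read 1 = 0. So the maximum is
    over a nonempty set.\<close>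
  have "V \<noteq> {} \<or> E \<noteq> {}"
    using cert by (auto simp: coloring_certificate_def)
  then have "coloring_certificate_degree V E P R \<le> d \<longleftrightarrow>
      (\<forall>x\<in>(\<lambda>i. poly_degree (P i)) ` V \<union> (\<lambda>e. poly_degree (R e)) ` E. x \<le> d)"
    unfolding coloring_certificate_degree_def using fin by (intro Max_le_iff) auto
  then show ?thesis
    using cert by (auto simp: polys_upto_iff coloring_certificate_def)
qed

lemma coloring_certificate_degree_ge_4:
  fixes E :: "'v set set"
  assumes graph: "simple_graph V E" and cert: "coloring_certificate V E P R"
  shows "4 \<le> coloring_certificate_degree V E P R"
proof (rule ccontr)
  assume "\<not> ?thesis"
  then have "coloring_certificate_degree V E P R \<le> 3"
    by simp
  then have R: "\<forall>e\<in>E. R e \<in> polys_upto V 3"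
    using coloring_certificate_degree_le_iff[OF graph cert] by blast
  let ?L = "lin_ext coloring_weight :: 'v cpoly \<Rightarrow> complex"
  \<comment> \<open>Multiples of the vertex generators vanish in every degree; the degree bound
    enters only through the edges.\<close>
  have vertex: "?L (p * (X i ^ 3 - 1)) = 0" for p i
    by (simp add: right_diff_distrib lin_ext_diff X_power lin_ext_mult_single coloring_weight_cube)
  have edge: "?L (R e * edge_poly e) = 0" if "e \<in> E" for e
  proof -
    obtain i j where e: "i \<noteq> j" "e = {i, j}"
      using graph \<open>e \<in> E\<close> by (auto elim: simple_graph_edgeE)
    have "edge_poly e = Poly_Mapping.single (Poly_Mapping.single i 2) 1 +
        Poly_Mapping.single (Poly_Mapping.single i 1 + Poly_Mapping.single j 1) 1 +
        Poly_Mapping.single (Poly_Mapping.single j 2) 1"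
      using e by (simp add: edge_poly_doubleton X_power) (simp add: X_def mult_single)
    then have "?L (R e * edge_poly e) = lin_ext (\<lambda>m. coloring_weight (m + Poly_Mapping.single i 2) +
        coloring_weight (m + (Poly_Mapping.single i 1 + Poly_Mapping.single j 1)) +
        coloring_weight (m + Poly_Mapping.single j 2)) (R e)"
      by (simp add: distrib_left lin_ext_add lin_ext_mult_single lin_ext_fun_add)
    also have "\<dots> = 0"
      using R \<open>e \<in> E\<close> coloring_weight_edge[OF e(1)] by (intro lin_ext_eq_0) (auto simp: polys_upto_def)
    finally show ?thesis .
  qed
  have 1: "1 = (\<Sum>i\<in>V. P i * (X i ^ 3 - 1)) + (\<Sum>e\<in>E. R e * edge_poly e)"
    using cert by (simp add: coloring_certificate_def)
  have "?L 1 = (\<Sum>i\<in>V. ?L (P i * (X i ^ 3 - 1))) + (\<Sum>e\<in>E. ?L (R e * edge_poly e))"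
    using arg_cong[OF 1, of ?L] unfolding lin_ext_add lin_ext_sum .
  also have "\<dots> = 0"
    by (simp add: vertex edge)
  finally show False
    by (simp add: coloring_weight_def)
qed

section \<open>Certificates of degree four from odd wheels and cliques\<close>

abbreviation coloring_comb :: "'v set \<Rightarrow> 'v set set \<Rightarrow> nat \<Rightarrow> 'v cpoly \<Rightarrow> bool" where
  "coloring_comb V E \<equiv> bounded_comb V E (\<lambda>i. X i ^ 3 - 1) edge_poly"

text \<open>Write f_uv for the edge polynomials. Since f_ac - f_bc = (a - b)(a + b + c) and f_ab +
  (2a + b)(a - b) = 3 a^2, the combination (a + b + c) f_ab + (2a + b)(f_ac - f_bc) equals 3 a^2 (a
  + b + c).\<close>

lemma coloring_comb_triangle:
  assumes graph: "simple_graph V E" and V: "{a, b, c} \<subseteq> V" and ne: "a \<noteq> b" "a \<noteq> c" "b \<noteq> c"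
    and E: "{a, b} \<in> E" "{a, c} \<in> E" "{b, c} \<in> E"
  shows "coloring_comb V E 1 ((X a)\<^sup>2 * (X a + X b + X c))"
proof -
  have *: "coloring_comb V E 1 (q * edge_poly e)" if "q \<in> polys_upto V 1" "e \<in> E" for q e
    using bounded_comb_edge[OF simple_graph_finite_edges[OF graph] that(2,1)] .
  have X: "X v \<in> polys_upto V 1" if "v \<in> {a, b, c}" for v
    using that V by (intro polys_upto_X) auto
  have "coloring_comb V E 1 ((X a + X b + X c) * edge_poly {a, b} +
      ((X a + X a + X b) * edge_poly {a, c} - (X a + X a + X b) * edge_poly {b, c}))"
    by (intro bounded_comb_add bounded_comb_diff * polys_upto_add X E) simp_all
  also have "(X a + X b + X c) * edge_poly {a, b} +
      ((X a + X a + X b) * edge_poly {a, c} - (X a + X a + X b) * edge_poly {b, c}) =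
      3 * ((X a)\<^sup>2 * (X a + X b + X c))"
    using ne by (simp add: edge_poly_doubleton power2_eq_square algebra_simps)
  finally have "coloring_comb V E 1 (Poly_Mapping.single 0 (1 / 3) * (3 * ((X a)\<^sup>2 * (X a + X b + X c))))"
    by (rule bounded_comb_const_mult)
  moreover have "Poly_Mapping.single 0 (1 / 3 :: complex) * (3 * p) = p" for p :: "'a cpoly"
    by (simp add: mult_single flip: mult.assoc single_numeral)
  ultimately show ?thesis
    by simp
qed

lemma coloring_comb_odd_wheel:
  assumes graph: "simple_graph V E" and V: "insert c (set rim) \<subseteq> V"
    and rim: "distinct rim" "odd (length rim)" "length rim \<ge> 3" "c \<notin> set rim"
    and rim_edges: "\<And>i. i < length rim \<Longrightarrow> {rim ! i, rim ! (Suc i mod length rim)} \<in> E"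
    and spokes: "\<And>v. v \<in> set rim \<Longrightarrow> {c, v} \<in> E"
  shows "coloring_comb V E 4 1"
proof -
  define a where "a = X c"
  define y where "y i = X (rim ! i)" for i
  let ?m = "length rim"
  have cV: "c \<in> V" and finV: "finite V" and finE: "finite E"
    using V graph simple_graph_finite_edges by (auto simp: simple_graph_def)
  have aV: "a ^ k \<in> polys_upto V k" for k
    unfolding a_def using polys_upto_power[OF polys_upto_X[OF cV], of k] by simp
  have tri: "coloring_comb V E 1 (a\<^sup>2 * (a + y i + y (Suc i mod ?m)))" if "i < ?m" for i
    unfolding a_def y_def
  proof (rule coloring_comb_triangle[OF graph])
    have i': "Suc i mod ?m < ?m" "Suc i mod ?m \<noteq> i"
      using rim(3) that by (auto simp: mod_Suc)
    then show "rim ! i \<noteq> rim ! (Suc i mod ?m)"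
      using rim(1) that by (simp add: nth_eq_iff_index_eq)
    show "{c, rim ! i, rim ! (Suc i mod ?m)} \<subseteq> V" "c \<noteq> rim ! i" "c \<noteq> rim ! (Suc i mod ?m)"
      "{c, rim ! i} \<in> E" "{c, rim ! (Suc i mod ?m)} \<in> E" "{rim ! i, rim ! (Suc i mod ?m)} \<in> E"
      using V rim(4) rim_edges that i' spokes nth_mem by (auto simp: subset_iff)
  qed
  \<comment> \<open>Subtracting the relations of two consecutive triangles gives a^2 (y_{i+2} -
    y_i); these differences telescope along the even positions of the rim.\<close>
  have even: "coloring_comb V E 1 (a\<^sup>2 * (y (2 * j) - y 0))" if "2 * j < ?m" for j
    using that
  proof (induction j)
    case (Suc j)
    have "coloring_comb V E 1 (a\<^sup>2 * (y (2 * j) - y 0) +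
        (a\<^sup>2 * (a + y (Suc (2 * j)) + y (Suc (Suc (2 * j)))) - a\<^sup>2 * (a + y (2 * j) + y (Suc (2 * j)))))"
      using Suc tri[of "2 * j"] tri[of "Suc (2 * j)"]
      by (intro bounded_comb_add bounded_comb_diff) simp_all
    then show ?case
      by (simp add: algebra_simps)
  qed simp
  have last: "Suc (?m - 1) = ?m" "?m - 1 < ?m"
    using rim(3) by simp_all
  \<comment> \<open>The rim is odd, so its last index is even and y_{m-1} can be replaced by y_0 in
    the triangle that closes the cycle.\<close>
  have "coloring_comb V E 1 (a\<^sup>2 * (a + y (?m - 1) + y 0) - a\<^sup>2 * (y (?m - 1) - y 0))"
  proof (rule bounded_comb_diff)
    show "coloring_comb V E 1 (a\<^sup>2 * (a + y (?m - 1) + y 0))"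
      using tri[OF last(2)] unfolding last(1) by simp
    obtain j where "?m = 2 * j + 1"
      using rim(2) by (rule oddE)
    then show "coloring_comb V E 1 (a\<^sup>2 * (y (?m - 1) - y 0))"
      using even[of j] by simp
  qed
  also have "a\<^sup>2 * (a + y (?m - 1) + y 0) - a\<^sup>2 * (y (?m - 1) - y 0) = a\<^sup>2 * (a + y 0 + y 0)"
    by (simp add: algebra_simps)
  finally have half: "coloring_comb V E 1 (a\<^sup>2 * (a + y 0 + y 0))" .
  have r0: "rim ! 0 \<in> set rim"
    using rim(3) by (cases rim) auto
  have "y 0 \<in> polys_upto V 1"
    unfolding y_def using r0 V by (intro polys_upto_X) auto
  then have "a + y 0 + y 0 \<in> polys_upto V 1"
    using aV[of 1] by (intro polys_upto_add) simp_all
  \<comment> \<open>One factor serves as a multiplier of degree 3, the other as a combination with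
    coefficients of degree 1: this is where degree 4 arises.\<close>
  then have "coloring_comb V E (2 + 1 + 1) (a\<^sup>2 * (a + y 0 + y 0) * (a\<^sup>2 * (a + y 0 + y 0)))"
    using aV half by (intro bounded_comb_mult polys_upto_mult)
  then have square: "coloring_comb V E 4 (a\<^sup>2 * (a + y 0 + y 0) * (a\<^sup>2 * (a + y 0 + y 0)))"
    by simp
  have "coloring_comb V E 4 (a ^ 4 * edge_poly {c, rim ! 0})"
    using bounded_comb_edge[OF finE spokes[OF r0] aV] .
  then have edge: "coloring_comb V E 4 (4 * (a ^ 4 * edge_poly {c, rim ! 0}))"
    using bounded_comb_const_mult[of V E _ _ 4 _ 4] by simp
  have "a ^ 3 + 1 \<in> polys_upto V 4"
    using polys_upto_mono[OF aV] by (intro polys_upto_add) simp_all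
  then have "coloring_comb V E 4 ((a ^ 3 + 1) * (a ^ 3 - 1))"
    unfolding a_def using bounded_comb_vertex[OF finV cV] by blast
  then have cube: "coloring_comb V E 4 (3 * ((a ^ 3 + 1) * (a ^ 3 - 1)))"
    using bounded_comb_const_mult[of V E _ _ 4 _ 3] by simp
  \<comment> \<open>With x = y_0 and f the edge polynomial of the spoke, 4 f - (a + 2x)^2 = 3 a^2.
    Multiplying by a^4 gives 3 a^6, and subtracting 3 (a^6 - 1) leaves 3.\<close>
  have "4 * (a ^ 4 * edge_poly {c, rim ! 0}) - a\<^sup>2 * (a + y 0 + y 0) * (a\<^sup>2 * (a + y 0 + y 0)) -
      3 * ((a ^ 3 + 1) * (a ^ 3 - 1)) = 3"
    using rim(4) r0 unfolding a_def y_def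
    by (subst edge_poly_doubleton) (auto simp: algebra_simps eval_nat_numeral)
  then have "coloring_comb V E 4 3"
    using bounded_comb_diff[OF bounded_comb_diff[OF edge square] cube] by simp
  then have "coloring_comb V E 4 (Poly_Mapping.single 0 (1 / 3) * 3)"
    by (rule bounded_comb_const_mult)
  then show ?thesis
    by (simp add: mult_single flip: single_numeral)
qed

lemma subgraph_odd_wheel_coloring_comb:
  assumes graph: "simple_graph V E" and sub: "subgraph W F V E" and wheel: "is_odd_wheel W F"
  shows "coloring_comb V E 4 1"
proof -
  obtain c rim where rim: "distinct rim" "odd (length rim)" "length rim \<ge> 3" "c \<notin> set rim"
    and W: "W = insert c (set rim)"
    and F: "F = {{rim ! i, rim ! (Suc i mod length rim)} | i. i < length rim} \<union> {{c, v} | v. v \<in> set rim}"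
    using wheel unfolding is_odd_wheel_def by blast
  show ?thesis
    by (rule coloring_comb_odd_wheel[OF graph _ rim]) (use sub W F in \<open>auto simp: subgraph_def\<close>)
qed

text \<open>Any four vertices of the clique form an odd wheel: one is the center, the other three
  are a triangular rim.\<close>

lemma subgraph_clique_coloring_comb:
  assumes graph: "simple_graph V E" and sub: "subgraph W F V E"
    and clique: "is_clique m W F" and "m \<ge> 4"
  shows "coloring_comb V E 4 1"
proof -
  obtain ys where ys: "set ys = W" "distinct ys"
    using clique finite_distinct_list unfolding is_clique_def by blast
  then have "length ys \<ge> 4"
    using clique \<open>m \<ge> 4\<close> unfolding is_clique_def by (metis distinct_card)
  define xs where "xs = take 4 ys"
  have xs: "distinct xs" "set xs \<subseteq> W" and "length xs = 4"
    using ys \<open>length ys \<ge> 4\<close> by (auto simp: xs_def dest: in_set_takeD)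
  then obtain a b c d where abcd: "xs = [a, b, c, d]"
    by (auto simp: length_Suc_conv eval_nat_numeral)
  have E: "{i, j} \<in> E" if "i \<in> W" "j \<in> W" "i \<noteq> j" for i j
    using clique sub that unfolding is_clique_def subgraph_def by blast
  show ?thesis
  proof (rule coloring_comb_odd_wheel[OF graph])
    show "{[b, c, d] ! i, [b, c, d] ! (Suc i mod length [b, c, d])} \<in> E" if "i < length [b, c, d]" for i
    proof -
      have "i = 0 \<or> i = 1 \<or> i = 2"
        using that by auto
      then show ?thesis
        using xs abcd by (auto intro!: E)
    qed
    show "insert a (set [b, c, d]) \<subseteq> V"
      using sub xs abcd by (auto simp: subgraph_def)
    show "{a, v} \<in> E" if "v \<in> set [b, c, d]" for v
      using that xs abcd by (intro E) auto
  qed (use xs abcd in auto)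
qed

lemma coloring_certificate_of_comb:
  assumes graph: "simple_graph V E" and "coloring_comb V E d 1"
  obtains P R where "coloring_certificate V E P R" "coloring_certificate_degree V E P R \<le> d"
proof -
  obtain P R where *: "\<forall>i\<in>V. P i \<in> polys_upto V d" "\<forall>e\<in>E. R e \<in> polys_upto V d"
    "1 = (\<Sum>i\<in>V. P i * (X i ^ 3 - 1)) + (\<Sum>e\<in>E. R e * edge_poly e)"
    using assms(2) unfolding bounded_comb_def by blast
  then have cert: "coloring_certificate V E P R"
    by (simp add: coloring_certificate_def polys_upto_iff)
  then show ?thesis
    using that * coloring_certificate_degree_le_iff[OF graph cert] by blast
qed

text \<open>Each degree is pinned down by a lower bound for all certificates and a constructed
  certificate attaining it. The existence claims ensure that the assertions about minimum-degree
  certificates are not vacuous.\<close>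

theorem theorem1p2:
  fixes n :: nat and E :: "nat set set"
  assumes graph: "simple_graph {1..n} E"
  shows
    "(\<forall>r::nat. r \<ge> 1 \<longrightarrow>
        (\<exists>A Q R. min_stable_certificate {1..n} E (stability_number {1..n} E + r) A Q R) \<and>
        (\<forall>A Q R. min_stable_certificate {1..n} E (stability_number {1..n} E + r) A Q R \<longrightarrow>
           stable_certificate_degree {1..n} E A Q R = stability_number {1..n} E \<and>
           stable_certificate_terms {1..n} E A Q R \<ge> card (stable_sets {1..n} E)))
     \<and>
     (\<not> three_colorable {1..n} E \<longrightarrow>
        (\<forall>P R. coloring_certificate {1..n} E P R \<longrightarrow>
           coloring_certificate_degree {1..n} E P R \<ge> 4))
     \<and>
     ((\<exists>W F. subgraph W F {1..n} E \<and> (is_odd_wheel W F \<or> (\<exists>m\<ge>4. is_clique m W F))) \<longrightarrow>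
        (\<exists>P R. min_coloring_certificate {1..n} E P R) \<and>
        (\<forall>P R. min_coloring_certificate {1..n} E P R \<longrightarrow>
           coloring_certificate_degree {1..n} E P R = 4))"
proof (intro conjI)
  show "\<forall>r::nat. r \<ge> 1 \<longrightarrow>
        (\<exists>A Q R. min_stable_certificate {1..n} E (stability_number {1..n} E + r) A Q R) \<and>
        (\<forall>A Q R. min_stable_certificate {1..n} E (stability_number {1..n} E + r) A Q R \<longrightarrow>
           stable_certificate_degree {1..n} E A Q R = stability_number {1..n} E \<and>
           stable_certificate_terms {1..n} E A Q R \<ge> card (stable_sets {1..n} E))"
  proof (intro allI impI)
    fix r :: nat assume "r \<ge> 1"
    let ?k = "stability_number {1..n} E + r"
    have k: "stability_number {1..n} E < ?k"
      using \<open>r \<ge> 1\<close> by simp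
    note ge = stable_certificate_degree_ge[OF graph _ k]
    obtain A Q R where AQR: "stable_certificate {1..n} E ?k A Q R"
      "stable_certificate_degree {1..n} E A Q R \<le> stability_number {1..n} E"
      using stable_certificate_exists[OF graph k] .
    \<comment> \<open>The constructed certificate meets the general lower bound and is therefore
      minimal; every other minimal one then has the same degree.\<close>
    have "min_stable_certificate {1..n} E ?k A Q R"
      unfolding min_stable_certificate_def using AQR ge by (meson order_trans)
    moreover have "stable_certificate_degree {1..n} E A' Q' R' = stability_number {1..n} E \<and>
        stable_certificate_terms {1..n} E A' Q' R' \<ge> card (stable_sets {1..n} E)"
      if min: "min_stable_certificate {1..n} E ?k A' Q' R'" for A' Q' R'
    proof
      have cert: "stable_certificate {1..n} E ?k A' Q' R'"
        using min by (simp add: min_stable_certificate_def)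
      show "stable_certificate_degree {1..n} E A' Q' R' = stability_number {1..n} E"
        using min AQR ge[OF cert] unfolding min_stable_certificate_def by (meson order_antisym order_trans)
      show "stable_certificate_terms {1..n} E A' Q' R' \<ge> card (stable_sets {1..n} E)"
        using stable_certificate_terms_ge[OF graph cert k] .
    qed
    ultimately show "(\<exists>A Q R. min_stable_certificate {1..n} E ?k A Q R) \<and>
        (\<forall>A Q R. min_stable_certificate {1..n} E ?k A Q R \<longrightarrow>
           stable_certificate_degree {1..n} E A Q R = stability_number {1..n} E \<and>
           stable_certificate_terms {1..n} E A Q R \<ge> card (stable_sets {1..n} E))"
      by blast
  qed
next
  show "\<not> three_colorable {1..n} E \<longrightarrow>
      (\<forall>P R. coloring_certificate {1..n} E P R \<longrightarrow> coloring_certificate_degree {1..n} E P R \<ge> 4)"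
    using coloring_certificate_degree_ge_4[OF graph] by blast
next
  show "(\<exists>W F. subgraph W F {1..n} E \<and> (is_odd_wheel W F \<or> (\<exists>m\<ge>4. is_clique m W F))) \<longrightarrow>
      (\<exists>P R. min_coloring_certificate {1..n} E P R) \<and>
      (\<forall>P R. min_coloring_certificate {1..n} E P R \<longrightarrow> coloring_certificate_degree {1..n} E P R = 4)"
  proof
    assume "\<exists>W F. subgraph W F {1..n} E \<and> (is_odd_wheel W F \<or> (\<exists>m\<ge>4. is_clique m W F))"
    then have "coloring_comb {1..n} E 4 1"
      using subgraph_odd_wheel_coloring_comb[OF graph] subgraph_clique_coloring_comb[OF graph] by blast
    then obtain P R where PR: "coloring_certificate {1..n} E P R"
      "coloring_certificate_degree {1..n} E P R \<le> 4"
      using coloring_certificate_of_comb[OF graph] by blast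
    note ge = coloring_certificate_degree_ge_4[OF graph]
    have "min_coloring_certificate {1..n} E P R"
      unfolding min_coloring_certificate_def using PR ge by (meson order_trans)
    moreover have "coloring_certificate_degree {1..n} E P' R' = 4"
      if "min_coloring_certificate {1..n} E P' R'" for P' R'
      using that PR ge[of P' R'] unfolding min_coloring_certificate_def
      by (meson order_antisym order_trans)
    ultimately show "(\<exists>P R. min_coloring_certificate {1..n} E P R) \<and>
      (\<forall>P R. min_coloring_certificate {1..n} E P R \<longrightarrow> coloring_certificate_degree {1..n} E P R = 4)"
      by blast
  qed
qed

end
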